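(* For $d\in\mathbb{N}$ let $$F_d^1:=\left\{ f\in C([0,1)^d)\;\middle|\; \|f\|:=\sum_{\boldsymbol{k}\in \mathbb{Z}^{d}}|\hat{f}(\boldsymbol{k})|\max\left(1,\min_{j\in \mathrm{supp}(\boldsymbol{k})}\log |k_j|\right)<\infty \right\}.$$ Then for any $d\in\mathbb{N}$, any $n\in\mathbb{N}$ with $n>2d$, and any linear algorithm $Q_{d,n}$ using $n$ function values, $$e^{\mathrm{wor}}(F_d^1,Q_{d,n})\geq \frac{d}{2n^2}.$$
   Context: Here $\mathbb{N}=\{1,2,\ldots\}$ and $\log$ is the natural logarithm. Functions $f$ are real-valued on $[0,1)^d$; elements of $C([0,1)^d)$ are continuous functions, taken to be integrable so that the Fourier coefficients $$\hat{f}(\boldsymbol{k})=\int_{[0,1)^d}f(\boldsymbol{x})\exp(-2\pi i\,\boldsymbol{k}\cdot\boldsymbol{x})\,\mathrm{d}\boldsymbol{x},\qquad \boldsymbol{k}\in\mathbb{Z}^d,$$ are defined. For $\boldsymbol{k}=(k_1,\ldots,k_d)\in\mathbb{Z}^d$, $\mathrm{supp}(\boldsymbol{k}):=\{j\in\{1,\ldots,d\}\mid k_j\neq 0\}$. For $\boldsymbol{k}=\boldsymbol{0}$ the minimum over the empty set is disregarded, so that the factor $\max(\cdot,\cdot)$ equals $1$. For an integrand $f$, write $I_d(f)=\int_{[0,1)^d}f(\boldsymbol{x})\,\mathrm{d}\boldsymbol{x}$. A linear algorithm using $n$ function values is $Q_{d,n}(f)=\sum_{h=0}^{n-1}w_hf(\boldsymbol{x}_h)$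 with sampling points $\boldsymbol{x}_0,\ldots,\boldsymbol{x}_{n-1}\in[0,1)^d$ and real weights $w_0,\ldots,w_{n-1}$. Its worst-case error in a Banach space $F$ with norm $\|\cdot\|$ is $$e^{\mathrm{wor}}(F,Q_{d,n}):=\sup_{f\in F,\ \|f\|\leq 1}|I_d(f)-Q_{d,n}(f)|.$$ *)

theory Defs
  imports "HOL-Analysis.Analysis"
begin

text \<open>
  The dimension \<open>d\<close> is the cardinality of the finite index type \<open>'d\<close>.  Functions on \<open>[0,1)\<^sup>d\<close> are
  represented by total functions on \<open>real ^ 'd\<close>; everything below depends only on their
  values on the cube.
\<close>

definition unit_cube :: "(real ^ 'd) set" where
  "unit_cube = {x. \<forall>j. 0 \<le> x $ j \<and> x $ j < 1}"

definition fourier_coeff :: "(real ^ 'd \<Rightarrow> real) \<Rightarrow> int ^ 'd \<Rightarrow> complex" where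
  "fourier_coeff f k =
     (LINT x:unit_cube|lborel.
        complex_of_real (f x) *
        exp (- 2 * complex_of_real pi * \<i> * complex_of_real (\<Sum>j\<in>UNIV. of_int (k $ j) * x $ j)))"

definition supp :: "int ^ 'd \<Rightarrow> 'd set" where
  "supp k = {j. k $ j \<noteq> 0}"

definition freq_weight :: "int ^ 'd \<Rightarrow> real" where
  "freq_weight k =
     (if supp k = {} then 1
      else max 1 (Min ((\<lambda>j. ln (real_of_int \<bar>k $ j\<bar>)) ` supp k)))"

text \<open>
  The norm is a possibly infinite sum of non-negative terms, hence \<open>ennreal\<close>-valued; there every
  family is summable.
\<close>

definition F1_norm :: "(real ^ 'd \<Rightarrow> real) \<Rightarrow> ennreal" where
  "F1_norm f = (\<Sum>\<^sub>\<infinity>k\<in>UNIV. ennreal (cmod (fourier_coeff f k) * freq_weight k))"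

definition F1 :: "(real ^ 'd \<Rightarrow> real) set" where
  "F1 = {f. continuous_on unit_cube f \<and> set_integrable lborel unit_cube f \<and> F1_norm f < \<infinity>}"

definition cube_integral :: "(real ^ 'd \<Rightarrow> real) \<Rightarrow> real" where
  "cube_integral f = (LINT x:unit_cube|lborel. f x)"

definition linear_algorithm ::
  "nat \<Rightarrow> (nat \<Rightarrow> real) \<Rightarrow> (nat \<Rightarrow> real ^ 'd) \<Rightarrow> (real ^ 'd \<Rightarrow> real) \<Rightarrow> real" where
  "linear_algorithm n w x f = (\<Sum>h<n. w h * f (x h))"

definition worst_case_error ::
  "(real ^ 'd \<Rightarrow> real) set \<Rightarrow> ((real ^ 'd \<Rightarrow> real) \<Rightarrow> ennreal) \<Rightarrow>
   ((real ^ 'd \<Rightarrow> real) \<Rightarrow> real) \<Rightarrow> ennreal" where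
  "worst_case_error F nrm Q =
     (SUP f\<in>{f \<in> F. nrm f \<le> 1}. ennreal \<bar>cube_integral f - Q f\<bar>)"

end

theory Submission imports Defs begin

text \<open>
  The bound comes from a function that vanishes at every sampling point, so that every choice of
  weights gives the value \<open>0\<close>, while its integral is large compared with its norm.

  Such a function is sought among trigonometric polynomials with frequencies in a finite set \<open>A\<close>.
  Vanishing at \<open>n\<close> points is a system of \<open>n\<close> homogeneous linear equations for the coefficients, so
  it has a nontrivial solution \<open>c\<close> as soon as \<open>A\<close> has more than \<open>n\<close> elements
  (\<open>underdetermined_system_has_nontrivial_solution\<close>).  Let \<open>c l\<close> be a coefficient of largest
  modulus, divide by it and multiply by the character of frequency \<open>- l\<close>.  This keeps the zeros,
  makes the constant coefficient, that is the integral, equal to \<open>1\<close>, and leaves the coefficients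
  bounded by \<open>1\<close>, at frequencies \<open>k - l\<close> with \<open>k \<in> A\<close>.  The real part has the same zeros
  and the same integral, and its norm is at most the sum of the weights of these frequencies
  (\<open>F1_norm_trig_poly_le\<close>).

  It remains to choose \<open>A\<close> with few elements and with differences of small weight.  Because the
  weight of a frequency only grows like the logarithm of its components, it is good to spread \<open>A\<close>
  over all \<open>d\<close> coordinate axes: the points at distance \<open>1, \<dots>, m\<close> from the
  origin on each positive half-axis, with \<open>m = n div d + 1\<close>, are more than \<open>n\<close> and at most \<open>n + d \<le> 2 * n\<close> in number, and their
  differences have components of modulus at most \<open>m\<close>, hence weight at most
  \<open>max 1 (ln m) \<le> n / d\<close>.  So the norm is at most \<open>2 * n\<^sup>2 / d\<close>, and normalising gives the claim.
\<close>

section \<open>Homogeneous linear systems\<close>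

text \<open>
  Gaussian elimination on the number of equations: the last equation expresses the unknown \<open>c p\<close>,
  for a \<open>p\<close> with nonzero coefficient there, through the others; substituting it into the remaining
  equations leaves a system with one equation and one unknown less.
\<close>

lemma underdetermined_system_has_nontrivial_solution:
  fixes v :: "'a \<Rightarrow> nat \<Rightarrow> 'f::field"
  assumes "finite A" "n < card A"
  shows "\<exists>c. (\<exists>k\<in>A. c k \<noteq> 0) \<and> (\<forall>h<n. (\<Sum>k\<in>A. c k * v k h) = 0)"
  using assms
proof (induction n arbitrary: A v)
  case 0
  then show ?case by (intro exI[of _ "\<lambda>_. 1"]) (auto simp: card_gt_0_iff)
next
  case (Suc n)
  show ?case
  proof (cases "\<forall>k\<in>A. v k n = 0")
    case True
    from Suc.IH[of A v] Suc.prems obtain c where c: "\<exists>k\<in>A. c k \<noteq> 0"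
      "\<forall>h<n. (\<Sum>k\<in>A. c k * v k h) = 0"
      by auto
    then show ?thesis using True by (intro exI[of _ c]) (auto simp: less_Suc_eq)
  next
    case False
    then obtain p where p: "p \<in> A" "v p n \<noteq> 0" by blast
    define A' where "A' = A - {p}"
    have A': "finite A'" "p \<notin> A'" "A = insert p A'" "n < card A'"
      using Suc.prems p by (auto simp: A'_def)
    from Suc.IH[OF A'(1,4), of "\<lambda>k h. v k h - v k n / v p n * v p h"]
    obtain c where c: "\<exists>k\<in>A'. c k \<noteq> 0"
      "\<forall>h<n. (\<Sum>k\<in>A'. c k * (v k h - v k n / v p n * v p h)) = 0"
      by blast
    define s where "s = (\<Sum>k\<in>A'. c k * v k n) / v p n"
    define c' where "c' = c(p := - s)"
    have eq: "(\<Sum>k\<in>A. c' k * v k h) = (\<Sum>k\<in>A'. c k * (v k h - v k n / v p n * v p h))" for h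
    proof -
      have "(\<Sum>k\<in>A'. c' k * v k h) = (\<Sum>k\<in>A'. c k * v k h)"
        using A'(2) by (intro sum.cong) (auto simp: c'_def)
      then show ?thesis
        using A' by (simp add: c'_def s_def sum_subtractf sum_distrib_right sum_divide_distrib
            right_diff_distrib mult.assoc)
    qed
    have "\<forall>h<Suc n. (\<Sum>k\<in>A. c' k * v k h) = 0"
      using c(2) p(2) unfolding eq by (auto simp: less_Suc_eq)
    moreover have "\<exists>k\<in>A. c' k \<noteq> 0"
      using c(1) A'(2,3) by (auto simp: c'_def)
    ultimately show ?thesis by blast
  qed
qed

section \<open>Characters of the torus\<close>

definition character :: "int ^ 'd \<Rightarrow> real ^ 'd \<Rightarrow> complex" where
  "character k x = exp (2 * of_real pi * \<i> * of_real (\<Sum>j\<in>UNIV. of_int (k $ j) * x $ j))"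

lemma character_add: "character (k + l) x = character k x * character l x"
  by (simp add: character_def exp_add[symmetric] algebra_simps sum.distrib)

lemma cnj_character: "cnj (character k x) = character (- k) x"
  by (simp add: character_def exp_cnj sum_negf)

lemma continuous_on_character: "continuous_on S (character k)"
  unfolding character_def by (intro continuous_intros)

lemma fourier_coeff_eq_character:
  "fourier_coeff f k = (LINT x:unit_cube|lborel. complex_of_real (f x) * character (- k) x)"
  by (simp add: fourier_coeff_def character_def sum_negf)

lemma cube_integral_eq_fourier_coeff: "complex_of_real (cube_integral f) = fourier_coeff f 0"
  by (simp add: cube_integral_def fourier_coeff_def set_integral_complex_of_real)

text \<open>
  Fubini's theorem for products of functions of one coordinate each.  Lebesgue measure is a product
  over the vectors of the standard basis, so these have to be matched with the coordinates they
  stand for; \<open>ix\<close> below recovers the coordinate from the basis vector.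
\<close>

lemma lborel_integral_prod_cart:
  fixes g :: "'d::finite \<Rightarrow> real \<Rightarrow> 'b::{real_normed_field,banach,second_countable_topology}"
  assumes int: "\<And>j. integrable lborel (g j)"
  shows "(LINT x|lborel. (\<Prod>j\<in>UNIV. g j ((x :: real ^ 'd) $ j))) = (\<Prod>j\<in>UNIV. (LINT t|lborel. g j t))"
proof -
  have [measurable]: "g j \<in> borel_measurable borel" for j
    using borel_measurable_integrable[OF int[of j]] by simp
  have [measurable]: "(\<lambda>x :: real ^ 'd. x $ j) \<in> borel_measurable borel" for j
    by (intro borel_measurable_continuous_onI continuous_intros)
  define ix :: "real ^ 'd \<Rightarrow> 'd" where "ix b = (THE j. b = axis j 1)" for b
  have ix: "ix (axis j 1) = j" for j
    by (auto simp: ix_def axis_eq_axis)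
  have Basis: "(Basis :: (real ^ 'd) set) = range (\<lambda>j. axis j 1)"
    by (auto simp: Basis_vec_def)
  have inj: "inj (\<lambda>j::'d. axis j (1::real))"
    by (auto simp: inj_on_def axis_eq_axis)
  have coord: "(\<Sum>b\<in>Basis. f b * b $ j) = f (axis j 1)" for f :: "real ^ 'd \<Rightarrow> real" and j
    unfolding Basis
    by (subst sum.reindex[OF inj]) (simp add: axis_def if_distrib sum.delta cong: if_cong)
  interpret product_sigma_finite "\<lambda>_ :: real ^ 'd. lborel :: real measure"
    by standard
  have "(LINT x|lborel. (\<Prod>j\<in>UNIV. g j ((x :: real ^ 'd) $ j)))
      = (LINT f|(\<Pi>\<^sub>M b\<in>(Basis :: (real ^ 'd) set). lborel). (\<Prod>j\<in>UNIV. g j (f (axis j 1))))"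
    by (subst lborel_eq, subst integral_distr) (auto simp: coord)
  also have "\<dots> = (LINT f|(\<Pi>\<^sub>M b\<in>(Basis :: (real ^ 'd) set). lborel). (\<Prod>b\<in>Basis. g (ix b) (f b)))"
    unfolding Basis by (subst prod.reindex[OF inj]) (simp add: ix)
  also have "\<dots> = (\<Prod>b\<in>(Basis :: (real ^ 'd) set). (LINT t|lborel. g (ix b) t))"
    by (rule product_integral_prod) (auto intro: int)
  also have "\<dots> = (\<Prod>j\<in>UNIV. (LINT t|lborel. g j t))"
    unfolding Basis by (subst prod.reindex[OF inj]) (simp add: ix)
  finally show ?thesis .
qed

text \<open>
  For \<open>k \<noteq> 0\<close> the antiderivative \<open>exp (a t) / a\<close> with \<open>a = 2 \<pi> i k\<close> has period \<open>1\<close>, so the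
  integral over a full period vanishes.
\<close>

lemma integral_character_1d:
  fixes k :: int
  defines "e \<equiv> \<lambda>t::real. exp (2 * of_real pi * \<i> * of_real (of_int k * t))"
  shows "integrable lborel (\<lambda>t. indicator {0..<1} t *\<^sub>R e t)"
    and "(LINT t|lborel. indicator {0..<1} t *\<^sub>R e t) = (if k = 0 then 1 else 0)"
proof -
  have cont: "continuous_on S e" for S
    unfolding e_def by (intro continuous_intros)
  (* The fundamental theorem of calculus is for closed intervals; the endpoint 1 is a null set. *)
  have Icc: "integrable lborel (\<lambda>t. indicator {0..1::real} t *\<^sub>R e t)"
    using cont by (intro borel_integrable_compact) auto
  have eqAE: "AE t in lborel. indicator {0..1::real} t *\<^sub>R e t = indicator {0..<1} t *\<^sub>R e t"
    by (rule AE_mp[OF AE_lborel_singleton[of 1]]) (auto simp: indicator_def)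
  have [measurable]: "e \<in> borel_measurable borel"
    by (rule borel_measurable_continuous_onI[OF cont])
  show "integrable lborel (\<lambda>t. indicator {0..<1} t *\<^sub>R e t)"
    using integrable_cong_AE[THEN iffD1, OF _ _ eqAE Icc] by simp
  have "(LINT t|lborel. indicator {0..<1} t *\<^sub>R e t) = (LINT t|lborel. indicator {0..1} t *\<^sub>R e t)"
    using eqAE by (intro integral_cong_AE) (auto elim: AE_mp)
  also have "\<dots> = (if k = 0 then 1 else 0)"
  proof (cases "k = 0")
    case True
    then show ?thesis by (simp add: e_def)
  next
    case False
    define a where "a = 2 * complex_of_real pi * \<i> * of_int k"
    have a: "a \<noteq> 0" using False by (simp add: a_def)
    have e: "e = (\<lambda>t. exp (a * of_real t))" by (simp add: e_def a_def mult_ac)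
    have "((\<lambda>t. exp (a * of_real t) / a) has_vector_derivative e t) (at t within {0..1})" for t
      unfolding e
      by (rule has_vector_derivative_real_field) (use a in \<open>auto intro!: derivative_eq_intros\<close>)
    then have "(LINT t|lborel. indicator {0..1} t *\<^sub>R e t)
        = exp (a * of_real 1) / a - exp (a * of_real 0) / a"
      by (intro integral_FTC_atLeastAtMost cont) auto
    moreover have "exp a = 1"
      unfolding a_def by (simp add: exp_eq_1 mult_ac)
    ultimately show ?thesis using False by simp
  qed
  finally show "(LINT t|lborel. indicator {0..<1} t *\<^sub>R e t) = (if k = 0 then 1 else 0)" .
qed

text \<open>
  Both the character and the indicator function of the cube factor over the coordinates, and one
  nonzero component of \<open>k\<close> suffices to make the product of the integrals vanish.
\<close>

lemma integral_character:
  fixes k :: "int ^ 'd"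
  shows "(LINT x:unit_cube|lborel. character k x) = (if k = 0 then 1 else 0)"
proof -
  let ?e = "\<lambda>j t. indicator {0..<1} t *\<^sub>R exp (2 * of_real pi * \<i> * of_real (of_int (k $ j) * t))"
  have "indicator unit_cube x *\<^sub>R character k x = (\<Prod>j\<in>UNIV. ?e j (x $ j))" for x
  proof -
    have "indicator unit_cube x = (\<Prod>j\<in>UNIV. indicator {0..<1} (x $ j) :: real)"
      by (auto simp: unit_cube_def indicator_def)
    then show ?thesis
      by (simp add: character_def sum_distrib_left exp_sum scaleR_conv_of_real prod.distrib)
  qed
  then have "(LINT x:unit_cube|lborel. character k x)
      = (LINT x|lborel. (\<Prod>j\<in>UNIV. ?e j ((x :: real ^ 'd) $ j)))"
    by (simp add: set_lebesgue_integral_def)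
  also have "\<dots> = (\<Prod>j\<in>UNIV. (LINT t|lborel. ?e j t))"
    by (rule lborel_integral_prod_cart) (rule integral_character_1d)
  also have "\<dots> = (\<Prod>j\<in>UNIV. if k $ j = 0 then 1 else 0)"
    by (simp only: integral_character_1d)
  also have "\<dots> = (if k = 0 then 1 else 0)"
    by (auto simp: vec_eq_iff)
  finally show ?thesis .
qed

section \<open>Real trigonometric polynomials\<close>

lemma set_integrable_unit_cube:
  fixes f :: "real ^ 'd \<Rightarrow> 'b::euclidean_space"
  assumes "continuous_on UNIV f"
  shows "set_integrable lborel unit_cube f"
proof -
  have "set_integrable lborel (cbox 0 (\<chi> j. 1)) f"
    unfolding set_integrable_def
    by (rule borel_integrable_compact) (use assms continuous_on_subset in \<open>auto\<close>)
  moreover have "(unit_cube :: (real ^ 'd) set) \<in> sets lborel"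
    unfolding unit_cube_def by measurable
  ultimately show ?thesis
    by (rule set_integrable_subset) (auto simp: unit_cube_def mem_box_cart less_imp_le)
qed

definition trig_poly :: "(int ^ 'd) set \<Rightarrow> (int ^ 'd \<Rightarrow> complex) \<Rightarrow> real ^ 'd \<Rightarrow> real" where
  "trig_poly B a x = Re (\<Sum>k\<in>B. a k * character k x)"

lemma continuous_on_trig_poly: "continuous_on S (trig_poly B a)"
  unfolding trig_poly_def[abs_def] by (intro continuous_intros continuous_on_character)

text \<open>
  The real part is half the sum of the polynomial and its conjugate, and conjugation moves the
  coefficient at \<open>k\<close>, conjugated, to \<open>- k\<close>.  As \<open>B\<close> may meet its reflection, both
  contributions can occur at the same frequency.
\<close>

lemma fourier_coeff_trig_poly:
  assumes "finite B"
  shows "fourier_coeff (trig_poly B a) m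
    = ((if m \<in> B then a m else 0) + (if - m \<in> B then cnj (a (- m)) else 0)) / 2"
proof -
  have split: "complex_of_real (trig_poly B a x) * character (- m) x
      = (\<Sum>k\<in>B. (a k / 2) * character (k - m) x + (cnj (a k) / 2) * character (- k - m) x)" for x
  proof -
    have "complex_of_real (trig_poly B a x)
        = ((\<Sum>k\<in>B. a k * character k x) + cnj (\<Sum>k\<in>B. a k * character k x)) / 2"
      unfolding trig_poly_def by (simp only: complex_add_cnj) simp
    also have "\<dots> = (\<Sum>k\<in>B. (a k / 2) * character k x + (cnj (a k) / 2) * character (- k) x)"
      by (simp add: cnj_character sum.distrib sum_divide_distrib add_divide_distrib)
    finally show ?thesis
      using character_add[of _ "- m" x]
      by (simp add: sum_distrib_right distrib_right mult.assoc)
  qed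
  have int: "integrable lborel (\<lambda>x. indicator unit_cube x *\<^sub>R (c * character k x))"
    for c and k :: "int ^ 'd"
    unfolding set_integrable_def[symmetric]
    by (intro set_integrable_unit_cube continuous_intros continuous_on_character)
  have "fourier_coeff (trig_poly B a) m
      = (\<Sum>k\<in>B. (a k / 2) * (LINT x:unit_cube|lborel. character (k - m) x)
               + (cnj (a k) / 2) * (LINT x:unit_cube|lborel. character (- k - m) x))"
    unfolding fourier_coeff_eq_character split set_integral_mult_right[symmetric]
    unfolding set_lebesgue_integral_def scaleR_sum_right scaleR_add_right
    by (subst Bochner_Integration.integral_sum)
      (intro Bochner_Integration.integrable_add int sum.cong refl Bochner_Integration.integral_add)+
  also have "\<dots> = (\<Sum>k\<in>B. (if k = m then a m / 2 else 0) + (if k = - m then cnj (a (- m)) / 2 else 0))"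
  proof (intro sum.cong refl arg_cong2[of _ _ _ _ plus])
    fix k
    show "a k / 2 * (LINT x:unit_cube|lborel. character (k - m) x) = (if k = m then a m / 2 else 0)"
      unfolding integral_character by simp
    have "- k - m = 0 \<longleftrightarrow> k = - m"
      by (metis add.inverse_inverse right_minus_eq)
    then show "cnj (a k) / 2 * (LINT x:unit_cube|lborel. character (- k - m) x)
        = (if k = - m then cnj (a (- m)) / 2 else 0)"
      unfolding integral_character by simp
  qed
  also have "\<dots> = ((if m \<in> B then a m else 0) + (if - m \<in> B then cnj (a (- m)) else 0)) / 2"
    using assms by (simp add: sum.distrib add_divide_distrib)
  finally show ?thesis .
qed

lemma freq_weight_nonneg: "0 \<le> freq_weight k"
  by (simp add: freq_weight_def le_max_iff_disj)

lemma freq_weight_uminus: "freq_weight (- k) = freq_weight k"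
  by (simp add: freq_weight_def supp_def)

text \<open>
  Passing to the real part spreads each coefficient evenly over \<open>k\<close> and \<open>- k\<close>.  These two
  frequencies have equal weight, so by the triangle inequality the norm does not exceed that of the
  complex polynomial.
\<close>

lemma F1_norm_trig_poly_le:
  fixes B :: "(int ^ 'd) set"
  assumes "finite B"
  shows "F1_norm (trig_poly B a) \<le> ennreal (\<Sum>k\<in>B. cmod (a k) * freq_weight k)"
proof -
  let ?b = "\<lambda>m. if m \<in> B then cmod (a m) * freq_weight m else 0"
  (* The spectrum of the real part lies in the symmetrization C, which turns the norm into a finite
     sum that is invariant under the reflection of the frequencies. *)
  define C where "C = B \<union> uminus ` B"
  have C: "finite C" "B \<subseteq> C" "uminus ` C = C"
    using assms by (auto simp: C_def image_Un image_image)
  have zero: "fourier_coeff (trig_poly B a) m = 0" if "m \<notin> C" for m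
  proof -
    have "- m \<notin> B" using that by (metis C_def UnI2 imageI minus_minus)
    then show ?thesis using that by (simp add: fourier_coeff_trig_poly[OF assms] C_def)
  qed
  have sum_b: "(\<Sum>m\<in>C. ?b m) = (\<Sum>k\<in>B. cmod (a k) * freq_weight k)"
    using C by (simp add: sum.inter_restrict[symmetric] Int_absorb1)
  have "(\<Sum>m\<in>C. ?b (- m)) = (\<Sum>m\<in>uminus ` C. ?b m)"
    by (subst sum.reindex) (auto simp: inj_on_def)
  then have sum_b_neg: "(\<Sum>m\<in>C. ?b (- m)) = (\<Sum>k\<in>B. cmod (a k) * freq_weight k)"
    using C(3) sum_b by simp
  have bound: "cmod (fourier_coeff (trig_poly B a) m) * freq_weight m \<le> (?b m + ?b (- m)) / 2" for m
  proof -
    have "cmod (fourier_coeff (trig_poly B a) m)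
        \<le> ((if m \<in> B then cmod (a m) else 0) + (if - m \<in> B then cmod (a (- m)) else 0)) / 2"
      unfolding fourier_coeff_trig_poly[OF assms] norm_divide
      by (auto intro!: divide_right_mono norm_triangle_le)
    then have "cmod (fourier_coeff (trig_poly B a) m) * freq_weight m
        \<le> ((if m \<in> B then cmod (a m) else 0) + (if - m \<in> B then cmod (a (- m)) else 0)) / 2
           * freq_weight m"
      by (rule mult_right_mono) (rule freq_weight_nonneg)
    also have "\<dots> = (?b m + ?b (- m)) / 2"
      by (simp add: freq_weight_uminus distrib_right)
    finally show ?thesis .
  qed
  have "F1_norm (trig_poly B a)
      = (\<Sum>\<^sub>\<infinity>m\<in>C. ennreal (cmod (fourier_coeff (trig_poly B a) m) * freq_weight m))"
    unfolding F1_norm_def by (rule infsum_cong_neutral) (auto simp: zero)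
  also have "\<dots> = ennreal (\<Sum>m\<in>C. cmod (fourier_coeff (trig_poly B a) m) * freq_weight m)"
    using C(1) by (simp add: sum_ennreal freq_weight_nonneg)
  also have "\<dots> \<le> ennreal (\<Sum>m\<in>C. (?b m + ?b (- m)) / 2)"
    by (intro ennreal_leI sum_mono bound)
  also have "(\<Sum>m\<in>C. (?b m + ?b (- m)) / 2) = ((\<Sum>m\<in>C. ?b m) + (\<Sum>m\<in>C. ?b (- m))) / 2"
    by (simp only: sum_divide_distrib[symmetric] sum.distrib)
  finally show ?thesis
    unfolding sum_b sum_b_neg by simp
qed

section \<open>The lower bound\<close>

text \<open>
  A minimum is bounded by any one of its entries.  Hence a uniform bound on the components is enough,
  irrespective of how many of them are nonzero.
\<close>

lemma freq_weight_le_max_ln: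
  assumes "\<And>j. \<bar>k $ j\<bar> \<le> int m"
  shows "freq_weight k \<le> max 1 (ln (real m))"
proof (cases "supp k = {}")
  case True
  then show ?thesis by (simp add: freq_weight_def)
next
  case False
  then obtain j where j: "j \<in> supp k" by blast
  have "Min ((\<lambda>j. ln (real_of_int \<bar>k $ j\<bar>)) ` supp k) \<le> ln (real_of_int \<bar>k $ j\<bar>)"
    using j by (intro Min_le) auto
  also have "\<dots> \<le> ln (real m)"
  proof -
    have "0 < \<bar>k $ j\<bar>" using j by (simp add: supp_def)
    then have "0 < real_of_int \<bar>k $ j\<bar>" by simp
    moreover have "real_of_int \<bar>k $ j\<bar> \<le> real m"
      using assms[of j] by (metis of_int_le_iff of_int_of_nat_eq)
    ultimately show ?thesis by simp
  qed
  finally show ?thesis using False by (auto simp: freq_weight_def)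
qed

text \<open>
  The extremal function is \<open>f\<close> below: \<open>B\<close> is the spectrum \<open>A\<close> shifted by \<open>- l\<close>, and the factor
  \<open>N = 2 * n\<^sup>2 / d\<close> in the coefficients \<open>a\<close> scales the norm down to at most \<open>1\<close>.
\<close>

theorem theorem2:
  fixes n :: nat and w :: "nat \<Rightarrow> real" and x :: "nat \<Rightarrow> real ^ 'd"
  assumes "n > 2 * CARD('d)"
    and "\<And>h. h < n \<Longrightarrow> x h \<in> unit_cube"
  shows "worst_case_error F1 F1_norm (linear_algorithm n w x)
           \<ge> ennreal (real CARD('d) / (2 * real n ^ 2))"
proof -
  define d where "d = CARD('d)"
  have d: "0 < d" "2 * d < n" using assms(1) by (simp_all add: d_def)
  define m where "m = n div d + 1"
  define A :: "(int ^ 'd) set" where "A = (\<lambda>(j, s). axis j (int s)) ` (UNIV \<times> {1..m})"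
  have inj: "inj_on (\<lambda>(j :: 'd, s). axis j (int s)) (UNIV \<times> {1..m})"
    by (auto simp: inj_on_def axis_eq_axis)
  have finA: "finite A" by (simp add: A_def)
  have cardA: "card A = d * m"
    unfolding A_def by (subst card_image[OF inj]) (simp add: d_def card_cartesian_product)
  have n_less: "n < card A"
    using d(1) dividend_less_times_div[of d n] by (simp add: cardA m_def)
  have card_le: "card A \<le> 2 * n"
    using d times_div_less_eq_dividend[of d n] unfolding cardA m_def distrib_left by linarith
  (* A nontrivial trigonometric polynomial with spectrum in A that vanishes at all nodes. *)
  obtain c where c: "\<exists>k\<in>A. c k \<noteq> 0"
    "\<And>h. h < n \<Longrightarrow> (\<Sum>k\<in>A. c k * character k (x h)) = 0"
    using underdetermined_system_has_nontrivial_solution[OF finA n_less, of "\<lambda>k h. character k (x h)"]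
    by blast
  define M where "M = Max ((\<lambda>k. cmod (c k)) ` A)"
  have "M \<in> (\<lambda>k. cmod (c k)) ` A"
    unfolding M_def using finA c(1) by (intro Max_in) auto
  then obtain l where l: "l \<in> A" "cmod (c l) = M" by auto
  have max_l: "cmod (c k) \<le> cmod (c l)" if "k \<in> A" for k
    unfolding l(2) M_def using finA that by (intro Max_ge) auto
  have cl: "c l \<noteq> 0"
    using c(1) max_l by (metis norm_le_zero_iff norm_zero)
  define N where "N = 2 * real n ^ 2 / real d"
  have N: "0 < N" using d by (simp add: N_def)
  define B where "B = (\<lambda>k. k - l) ` A"
  have inj_shift: "inj_on (\<lambda>k. k - l) A" by (auto simp: inj_on_def)
  have finB: "finite B" using finA by (simp add: B_def)
  define a where "a k = c (k + l) / (of_real N * c l)" for k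
  define f where "f = trig_poly B a"
  have node: "f (x h) = 0" if "h < n" for h
  proof -
    have "(\<Sum>k\<in>B. a k * character k (x h))
        = (\<Sum>k\<in>A. c k * character k (x h)) * (character (- l) (x h) / (of_real N * c l))"
      unfolding B_def sum.reindex[OF inj_shift] sum_distrib_right
      using character_add[of _ "- l" "x h"] by (simp add: a_def mult.assoc)
    then show ?thesis using c(2)[OF that] by (simp add: f_def trig_poly_def)
  qed
  have "0 \<in> B" using l(1) by (force simp: B_def)
  moreover have "a 0 = of_real (1 / N)"
    using cl by (simp add: a_def)
  ultimately have "complex_of_real (cube_integral f) = of_real (1 / N)"
    unfolding cube_integral_eq_fourier_coeff f_def fourier_coeff_trig_poly[OF finB] by simp
  then have integral: "cube_integral f = 1 / N"
    by (simp only: of_real_eq_iff)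
  have weight: "freq_weight k \<le> real n / real d" if "k \<in> B" for k
  proof -
    (* The components of elements of A lie between 0 and m, so those of a difference do between
       - m and m. *)
    have "\<bar>k $ j\<bar> \<le> int m" for j
      using that l(1) by (auto simp: B_def A_def axis_def)
    then have "freq_weight k \<le> max 1 (ln (real m))"
      by (rule freq_weight_le_max_ln)
    also have "ln (real m) \<le> real (n div d)"
      using ln_add_one_self_le_self[of "real (n div d)"] by (simp add: m_def add.commute)
    also have "real (n div d) \<le> real n / real d"
      by (rule of_nat_div_le_of_nat)
    (* No weight is below 1, so the bound n / d needs n to be at least d. *)
    also have "max 1 (real n / real d) = real n / real d"
      using d by (simp add: max_def field_simps)
    finally show ?thesis by (simp add: max.coboundedI2 max.mono)
  qed
  have coeff: "cmod (a k) \<le> 1 / N" if "k \<in> B" for k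
  proof -
    have "cmod (c (k + l)) \<le> cmod (c l)"
      using that by (intro max_l) (auto simp: B_def)
    then show ?thesis using N cl by (simp add: a_def norm_divide norm_mult field_simps)
  qed
  have "(\<Sum>k\<in>B. cmod (a k) * freq_weight k) \<le> (\<Sum>k\<in>B. 1 / N * (real n / real d))"
    using N by (intro sum_mono mult_mono coeff weight freq_weight_nonneg) auto
  also have "\<dots> = real (card A) * (1 / N * (real n / real d))"
    unfolding B_def using inj_shift by (simp add: card_image)
  also have "\<dots> \<le> (2 * real n) * (1 / N * (real n / real d))"
    using card_le N by (intro mult_right_mono) auto
  also have "\<dots> = 1"
    using d by (simp add: N_def field_simps power2_eq_square)
  finally have norm: "F1_norm f \<le> 1"
    using F1_norm_trig_poly_le[OF finB, of a] unfolding f_def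
    by (metis ennreal_1 ennreal_leI order_trans)
  then have "F1_norm f < \<infinity>"
    using ennreal_one_less_top le_less_trans by (simp add: order_le_less_trans)
  then have mem: "f \<in> {f \<in> F1. F1_norm f \<le> 1}"
    using norm by (auto simp: F1_def f_def continuous_on_trig_poly set_integrable_unit_cube)
  have "linear_algorithm n w x f = 0"
    by (simp add: linear_algorithm_def node)
  then have "\<bar>cube_integral f - linear_algorithm n w x f\<bar> = real CARD('d) / (2 * real n ^ 2)"
    using N by (simp add: integral) (simp add: N_def d_def)
  then show ?thesis
    unfolding worst_case_error_def using mem by (intro SUP_upper2[OF mem]) simp
qed

end
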